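(* Consider one step of diffusion inference with noise prediction from time $t_i$ to $t_{i-1}<t_i$, with intermediate time $s_i$ and nonzero step sizes $h_{t_i}=\kappa(t_{i-1})-\kappa(t_i)$ and $\hat h_{t_i}=\kappa(s_i)-\kappa(t_i)$. Suppose that $\boldsymbol{\epsilon}_\theta(\tilde{\boldsymbol{x}}_{t_i},t_i)$ and $\boldsymbol{\epsilon}_\theta(\tilde{\boldsymbol{x}}_{s_i},s_i)$ are independent $\mathbb{R}^d$-valued random noise terms with isotropic covariances $v_{t}\boldsymbol{I}$ and $v_{s}\boldsymbol{I}$, where $v_t=\mathrm{Var}(\boldsymbol{\epsilon}_\theta(\tilde{\boldsymbol{x}}_{t_i},t_i))>0$ and $v_s=\mathrm{Var}(\boldsymbol{\epsilon}_\theta(\tilde{\boldsymbol{x}}_{s_i},s_i))>0$. Let $p_1$ be the Gaussian transition of the first-order iteration $$\boldsymbol{f}(\tilde{\boldsymbol{x}}_{t_{i-1}})=\boldsymbol{f}(\tilde{\boldsymbol{x}}_{t_i})+h_{t_i}\boldsymbol{\epsilon}_\theta(\tilde{\boldsymbol{x}}_{t_i},t_i),$$ and let $p_2$ be the Gaussian transition of the gradient-based iteration $$\boldsymbol{f}(\tilde{\boldsymbol{x}}_{t_{i-1}})=\boldsymbol{f}(\tilde{\boldsymbol{x}}_{t_i})+h_{t_i}\boldsymbol{\epsilon}_\theta(\tilde{\boldsymbol{x}}_{t_i},t_i)+\frac{h_{t_i}^2}{2}\cdot\frac{\boldsymbol{\epsilon}_\theta(\tilde{\boldsymbol{x}}_{s_i},s_i)-\boldsymbol{\epsilon}_\theta(\tilde{\boldsymbol{x}}_{t_i},t_i)}{\hat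 h_{t_i}}.$$ If $$\frac{h_{t_i}}{\hat h_{t_i}}\in\left[1,\ \frac{4v_t}{v_s+v_t}\right],$$ then the gradient-based iteration has conditional entropy no larger than that of the first-order iteration: $$H_{p_2}(\tilde{\boldsymbol{x}}_{t_{i-1}}\mid\tilde{\boldsymbol{x}}_{t_i})\le H_{p_1}(\tilde{\boldsymbol{x}}_{t_{i-1}}\mid\tilde{\boldsymbol{x}}_{t_i}).$$
   Context: Here $\alpha_t,\sigma_t>0$ are scalar noise schedules, $\kappa(t)=\sigma_t/\alpha_t$, $\boldsymbol{f}(\boldsymbol{x}_t)=\boldsymbol{x}_t/\alpha_t$, and $\boldsymbol{\epsilon}_\theta(\cdot,t)$ is the noise-prediction model. The state $\tilde{\boldsymbol{x}}_{t_i}$ is given (conditioned on), and the model outputs $\boldsymbol{\epsilon}_\theta$ are treated as random perturbation terms that are mutually independent at different times. Each transition law of $\tilde{\boldsymbol{x}}_{t_{i-1}}$ given $\tilde{\boldsymbol{x}}_{t_i}$ is modelled as a Gaussian whose covariance is the one induced by the perturbation terms of the corresponding iteration (everything other than $\boldsymbol{f}(\tilde{\boldsymbol{x}}_{t_i})$). The conditional entropy is the Gaussian differential entropy $H=\frac{d}{2}(\log 2\pi+1)+\frac12\log\det\mathrm{Var}(\tilde{\boldsymbol{x}}_{t_{i-1}}\mid\tilde{\boldsymbol{x}}_{t_i})$. *)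

theory Defs
  imports "HOL-Probability.Probability"
begin

definition noise_ratio :: "(real \<Rightarrow> real) \<Rightarrow> (real \<Rightarrow> real) \<Rightarrow> real \<Rightarrow> real" where
  "noise_ratio \<sigma> \<alpha> t = \<sigma> t / \<alpha> t"

definition scaled_state :: "(real \<Rightarrow> real) \<Rightarrow> real \<Rightarrow> real ^ 'n \<Rightarrow> real ^ 'n" where
  "scaled_state \<alpha> t x = x /\<^sub>R \<alpha> t"

text \<open>A Bochner integral of a non-integrable function is 0, so entries of this matrix are
  meaningful only for square-integrable components. If \<open>M\<close> is a probability space, \<open>X\<close> is a
  random vector and all diagonal entries are positive, square-integrability is automatic.\<close>

definition covariance_matrix :: "'w measure \<Rightarrow> ('w \<Rightarrow> real ^ 'n) \<Rightarrow> real ^ 'n ^ 'n" where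
  "covariance_matrix M X =
     (\<chi> i j. \<integral>\<omega>. (X \<omega> $ i - (\<integral>\<omega>'. X \<omega>' $ i \<partial>M)) * (X \<omega> $ j - (\<integral>\<omega>'. X \<omega>' $ j \<partial>M)) \<partial>M)"

text \<open>The Gaussian law with mean \<open>m\<close> and covariance matrix \<open>S\<close>; only meaningful for symmetric
  positive definite \<open>S\<close>.\<close>

definition gaussian_density :: "real ^ 'n \<Rightarrow> real ^ 'n ^ 'n \<Rightarrow> real ^ 'n \<Rightarrow> real" where
  "gaussian_density m S x =
     exp (- ((x - m) \<bullet> (matrix_inv S *v (x - m))) / 2) / sqrt ((2 * pi) ^ CARD('n) * det S)"

definition gaussian_law :: "real ^ 'n \<Rightarrow> real ^ 'n ^ 'n \<Rightarrow> (real ^ 'n) measure" where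
  "gaussian_law m S = density lborel (\<lambda>x. ennreal (gaussian_density m S x))"

text \<open>The Gaussian differential entropy, in nats, of a transition law \<open>p\<close> (the conditional law of
  the next state given the current one), expressed through the covariance matrix of \<open>p\<close>.\<close>

definition gaussian_entropy :: "(real ^ 'n) measure \<Rightarrow> real" where
  "gaussian_entropy p =
     real CARD('n) / 2 * (ln (2 * pi) + 1) + ln (det (covariance_matrix p (\<lambda>x. x))) / 2"

end

theory Submission
  imports Defs
begin

text \<open>Put \<open>a = \<alpha> t_prev\<close> and \<open>r = h / h'\<close>. By independence both iterations have isotropic covariance:
  \<open>(a * h)\<^sup>2 * v_t\<close> for the first-order one and \<open>(a * h)\<^sup>2 * ((1 - r / 2)\<^sup>2 * v_t + (r / 2)\<^sup>2 * v_s)\<close>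
  for the gradient-based one. Expanding, the second is at most the first iff
  \<open>r\<^sup>2 * (v_s + v_t) \<le> 4 * r * v_t\<close>, which for \<open>r > 0\<close> is the upper bound on \<open>h / h'\<close>.
  The entropy of an isotropic Gaussian is increasing in its variance.\<close>

section \<open>Isotropic Gaussian laws: product density, moments, entropy\<close>

lemma borel_measurable_vec_nth' [measurable (raw)]:
  fixes f :: "'a \<Rightarrow> real ^ 'n"
  assumes "f \<in> borel_measurable M"
  shows "(\<lambda>x. f x $ i) \<in> borel_measurable M"
  by (rule measurable_compose[OF assms borel_measurable_nth])

text \<open>For a scalar covariance both the quadratic form and the determinant split over the
  coordinates, so integrals against the law reduce to one-dimensional normal integrals.
  \<open>normal_density\<close> takes a standard deviation, hence \<open>sqrt c\<close>.\<close>

lemma gaussian_density_isotropic: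
  fixes m x :: "real ^ 'n"
  assumes "c > 0"
  shows "gaussian_density m (c *\<^sub>R mat 1) x = (\<Prod>i\<in>UNIV. normal_density (m $ i) (sqrt c) (x $ i))"
proof -
  have inv: "matrix_inv (c *\<^sub>R mat 1 :: real ^ 'n ^ 'n) = inverse c *\<^sub>R mat 1"
    unfolding matrix_inv_def
  \<comment> \<open>\<open>matrix_inv\<close> is a Hilbert choice, so the candidate must be shown to
    be an inverse and to be the only one.\<close>
  proof (rule some_equality)
    fix B :: "real ^ 'n ^ 'n"
    assume "(c *\<^sub>R mat 1) ** B = mat 1 \<and> B ** (c *\<^sub>R mat 1) = mat 1"
    then have "c *\<^sub>R B = mat 1"
      by (simp add: scalar_matrix_assoc [symmetric])
    then have "inverse c *\<^sub>R (c *\<^sub>R B) = inverse c *\<^sub>R mat 1"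
      by simp
    then show "B = inverse c *\<^sub>R mat 1"
      using assms by simp
  qed (use assms in \<open>simp add: scalar_matrix_assoc [symmetric]\<close>)
  have det: "det (c *\<^sub>R mat 1 :: real ^ 'n ^ 'n) = c ^ CARD('n)"
    by (subst det_diagonal) (auto simp: mat_def)
  have "exp (- ((x - m) \<bullet> (inverse c *\<^sub>R (x - m))) / 2)
      = (\<Prod>i\<in>UNIV. exp (- (x $ i - m $ i)\<^sup>2 / (2 * c)))"
    unfolding inner_vec_def sum_negf [symmetric] sum_divide_distrib exp_sum [OF finite, symmetric]
    using assms by (intro arg_cong[where f = exp] sum.cong refl) (simp add: power2_eq_square field_simps)
  moreover have "sqrt ((2 * pi) ^ CARD('n) * c ^ CARD('n)) = (\<Prod>i\<in>(UNIV :: 'n set). sqrt (2 * pi * c))"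
    by (simp add: real_sqrt_power power_mult_distrib real_sqrt_mult)
  ultimately show ?thesis
    using assms
    by (simp add: gaussian_density_def inv det normal_density_def prod_dividef prod.distrib
        scaleR_matrix_vector_assoc [symmetric] power_divide)
qed

text \<open>This is Fubini: \<open>lborel\<close> is the image of the product measure indexed by
  \<open>Basis\<close>.\<close>

lemma has_bochner_integral_lborel_prod:
  fixes f :: "'a::euclidean_space \<Rightarrow> real \<Rightarrow> real"
  assumes int: "\<And>b. b \<in> Basis \<Longrightarrow> integrable lborel (f b)"
  shows "has_bochner_integral lborel (\<lambda>x. \<Prod>b\<in>Basis. f b (x \<bullet> b)) (\<Prod>b\<in>Basis. integral\<^sup>L lborel (f b))"
proof -
  interpret product_sigma_finite "\<lambda>_::'a. lborel :: real measure"
    by standard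
  have [measurable]: "f b \<in> borel_measurable borel" if "b \<in> Basis" for b
    using borel_measurable_integrable[OF int[OF that]] by simp
  show ?thesis
    by (subst lborel_eq, subst has_bochner_integral_distr)
       (auto simp: has_bochner_integral_iff int intro!: product_integrable_prod product_integral_prod)
qed

text \<open>The previous lemma is transported along the bijection from coordinate indices to the
  basis vectors \<open>axis i 1\<close>; \<open>inv ?e\<close> recovers the index of a basis
  vector.\<close>

lemma has_bochner_integral_lborel_prod_vec:
  fixes f :: "'n::finite \<Rightarrow> real \<Rightarrow> real"
  assumes "\<And>i. integrable lborel (f i)"
  shows "has_bochner_integral lborel (\<lambda>x :: real ^ 'n. \<Prod>i\<in>UNIV. f i (x $ i))
           (\<Prod>i\<in>UNIV. integral\<^sup>L lborel (f i))"
proof -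
  let ?e = "\<lambda>i::'n. axis i (1::real)"
  have inj: "inj ?e"
    by (simp add: inj_on_def axis_eq_axis)
  have basis: "Basis = range ?e"
    by (auto simp: Basis_vec_def)
  have "has_bochner_integral lborel (\<lambda>x :: real ^ 'n. \<Prod>b\<in>Basis. f (inv ?e b) (x \<bullet> b))
      (\<Prod>b\<in>Basis. integral\<^sup>L lborel (f (inv ?e b)))"
    using assms by (intro has_bochner_integral_lborel_prod)
  then show ?thesis
    by (simp add: basis prod.reindex[OF inj] o_def inv_f_f[OF inj] inner_axis)
qed

text \<open>The density is itself a product over the coordinates, so each of its factors is absorbed
  into the matching \<open>g i\<close> before Fubini is applied.\<close>

lemma integral_gaussian_law_isotropic:
  fixes m :: "real ^ 'n" and g :: "'n \<Rightarrow> real \<Rightarrow> real"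
  assumes "c > 0" and [measurable]: "\<And>i. g i \<in> borel_measurable borel"
    and int: "\<And>i. integrable lborel (\<lambda>x. normal_density (m $ i) (sqrt c) x * g i x)"
  shows "(\<integral>x. (\<Prod>i\<in>UNIV. g i (x $ i)) \<partial>gaussian_law m (c *\<^sub>R mat 1))
       = (\<Prod>i\<in>UNIV. \<integral>x. normal_density (m $ i) (sqrt c) x * g i x \<partial>lborel)"
proof -
  have "(\<integral>x. (\<Prod>i\<in>UNIV. g i (x $ i)) \<partial>gaussian_law m (c *\<^sub>R mat 1))
      = (\<integral>x. (\<Prod>i\<in>UNIV. normal_density (m $ i) (sqrt c) (x $ i) * g i (x $ i)) \<partial>lborel)"
    unfolding gaussian_law_def gaussian_density_isotropic[OF \<open>c > 0\<close>] prod.distrib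
    by (subst integral_density) (auto intro!: prod_nonneg)
  also have "\<dots> = (\<Prod>i\<in>UNIV. \<integral>x. normal_density (m $ i) (sqrt c) x * g i x \<partial>lborel)"
    by (rule has_bochner_integral_integral_eq[OF has_bochner_integral_lborel_prod_vec[OF int]])
  finally show ?thesis .
qed

lemma covariance_matrix_gaussian_law_isotropic:
  fixes m :: "real ^ 'n"
  assumes c: "c > 0"
  shows "covariance_matrix (gaussian_law m (c *\<^sub>R mat 1)) (\<lambda>x. x) = c *\<^sub>R mat 1"
proof -
  let ?p = "gaussian_law m (c *\<^sub>R mat 1)"
  let ?N = "\<lambda>i. normal_density (m $ i) (sqrt c)"
  have pos: "0 < sqrt c"
    using c by simp
  have moment0: "(\<integral>x. ?N i x \<partial>lborel) = 1"
    and moment1: "(\<integral>x. ?N i x * (x - m $ i) \<partial>lborel) = 0"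
    and moment2: "(\<integral>x. ?N i x * (x - m $ i)\<^sup>2 \<partial>lborel) = c" for i
    \<comment> \<open>These are the centered moments of orders 0, 1 and 2.\<close>
    using integral_normal_moment_even[OF pos, of "m $ i" 0]
      integral_normal_moment_odd[OF pos, of "m $ i" 0]
      integral_normal_moment_even[OF pos, of "m $ i" 1] c
    by (simp_all)
  have mean: "(\<integral>x. x $ i \<partial>?p) = m $ i" for i
  proof -
    \<comment> \<open>A single coordinate is padded with factors 1 to obtain the product form that
      factorizes.\<close>
    have "(\<integral>x. x $ i \<partial>?p) = (\<integral>x. (\<Prod>k\<in>UNIV. (if k = i then x $ k else 1)) \<partial>?p)"
      by simp
    also have "\<dots> = (\<Prod>k\<in>UNIV. \<integral>x. ?N k x * (if k = i then x else 1) \<partial>lborel)"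
    proof (rule integral_gaussian_law_isotropic[OF c, where g = "\<lambda>k x. if k = i then x else 1"])
      show "integrable lborel (\<lambda>x. ?N k x * (if k = i then x else 1))" for k
        using integrable_normal_moment_nz_1[OF pos] integrable_normal_density[OF pos]
        by (cases "k = i") simp_all
    qed simp
    also have "\<dots> = (\<Prod>k\<in>UNIV. if k = i then m $ k else 1)"
      using integral_normal_moment_nz_1[OF pos] moment0 by (intro prod.cong) auto
    finally show ?thesis
      by simp
  qed
  have "(\<integral>x. (x $ i - m $ i) * (x $ j - m $ j) \<partial>?p) = (c *\<^sub>R mat 1 :: real ^ 'n ^ 'n) $ i $ j" for i j
  proof -
    \<comment> \<open>\<open>?d k\<close> counts how often \<open>k\<close> occurs among
      \<open>i\<close> and \<open>j\<close>, so one product covers both the diagonal and the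
      off-diagonal entries.\<close>
    let ?d = "\<lambda>k. (if k = i then 1 else 0) + (if k = j then 1 else 0) :: nat"
    have "(\<integral>x. (x $ i - m $ i) * (x $ j - m $ j) \<partial>?p)
        = (\<integral>x. (\<Prod>k\<in>UNIV. (x $ k - m $ k) ^ ?d k) \<partial>?p)"
      by (simp add: power_add prod.distrib if_distrib[of "\<lambda>n. _ ^ n"] cong: if_cong)
    also have "\<dots> = (\<Prod>k\<in>UNIV. \<integral>x. ?N k x * (x - m $ k) ^ ?d k \<partial>lborel)"
      by (rule integral_gaussian_law_isotropic[OF c, where g = "\<lambda>k x. (x - m $ k) ^ ?d k"])
         (measurable, rule integrable_normal_moment[OF pos])
    also have "\<dots> = (if i = j then c else 0)"
    proof (cases "i = j")
      case True
      then have "(\<Prod>k\<in>UNIV. \<integral>x. ?N k x * (x - m $ k) ^ ?d k \<partial>lborel)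
          = (\<Prod>k\<in>UNIV. if k = i then c else 1)"
        using moment0 moment2 by (intro prod.cong) (auto simp: numeral_2_eq_2)
      then show ?thesis
        using True by simp
    next
      case False
      \<comment> \<open>Off the diagonal the exponent at \<open>i\<close> is 1, and this vanishing
        first moment annihilates the whole product.\<close>
      then have "(\<integral>x. ?N i x * (x - m $ i) ^ ?d i \<partial>lborel) = 0"
        using moment1 by simp
      then show ?thesis
        using False by (simp add: prod_zero_iff) blast
    qed
    finally show ?thesis
      by (simp add: mat_def)
  qed
  then show ?thesis
    by (simp add: covariance_matrix_def mean vec_eq_iff)
qed

text \<open>\<open>gaussian_entropy\<close> sees only the measure, so the covariance has to be
  recovered from the law first. The result does not depend on \<open>m\<close>, which allows laws
  with different means to be compared.\<close>

lemma gaussian_entropy_isotropic: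
  fixes m :: "real ^ 'n"
  assumes "c > 0"
  shows "gaussian_entropy (gaussian_law m (c *\<^sub>R mat 1))
       = real CARD('n) / 2 * (ln (2 * pi) + 1 + ln c)"
proof -
  have "det (c *\<^sub>R mat 1 :: real ^ 'n ^ 'n) = c ^ CARD('n)"
    by (subst det_diagonal) (auto simp: mat_def)
  then show ?thesis
    using assms
    by (simp add: gaussian_entropy_def covariance_matrix_gaussian_law_isotropic ln_realpow algebra_simps)
qed

section \<open>Covariance of combinations of independent random vectors\<close>

lemma integrable_mult_of_square_integrable:
  fixes f g :: "'a \<Rightarrow> real"
  assumes [measurable]: "f \<in> borel_measurable M" "g \<in> borel_measurable M"
    and "integrable M (\<lambda>x. (f x)\<^sup>2)" "integrable M (\<lambda>x. (g x)\<^sup>2)"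
  shows "integrable M (\<lambda>x. f x * g x)"
proof (rule Bochner_Integration.integrable_bound)
  show "integrable M (\<lambda>x. (f x)\<^sup>2 + (g x)\<^sup>2)"
    using assms by simp
  have "\<bar>a * b\<bar> \<le> a\<^sup>2 + b\<^sup>2" for a b :: real
    using sum_squares_bound[of "\<bar>a\<bar>" "\<bar>b\<bar>"] abs_ge_zero[of "a * b"]
    unfolding power2_abs abs_mult by linarith
  then show "AE x in M. norm (f x * g x) \<le> norm ((f x)\<^sup>2 + (g x)\<^sup>2)"
    by simp
qed simp

text \<open>Needed because the iterations determine the next state only on
  \<open>space M\<close>.\<close>

lemma covariance_matrix_cong:
  assumes "\<And>\<omega>. \<omega> \<in> space M \<Longrightarrow> X \<omega> = Y \<omega>"
  shows "covariance_matrix M X = covariance_matrix M Y"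
  using assms by (simp add: covariance_matrix_def cong: Bochner_Integration.integral_cong)

context prob_space
begin

text \<open>The Bochner integral of a non-integrable function is 0, so a nonzero diagonal entry
  forces the centered square to be integrable. On a probability space the shift by the constant
  \<open>e\<close> can then be undone.\<close>

lemma square_integrable_of_covariance_matrix_diagonal:
  fixes X :: "'a \<Rightarrow> real ^ 'n"
  assumes [measurable]: "X \<in> borel_measurable M"
    and "covariance_matrix M X $ i $ i \<noteq> 0"
  shows "integrable M (\<lambda>\<omega>. (X \<omega> $ i)\<^sup>2)"
proof -
  define e where "e = expectation (\<lambda>\<omega>. X \<omega> $ i)"
  have sq: "integrable M (\<lambda>\<omega>. (X \<omega> $ i - e)\<^sup>2)"
    using assms(2) not_integrable_integral_eq
    by (fastforce simp: covariance_matrix_def e_def power2_eq_square)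
  have "integrable M (\<lambda>\<omega>. X \<omega> $ i - e)"
    by (rule square_integrable_imp_integrable[OF _ sq]) simp
  then have "integrable M (\<lambda>\<omega>. (X \<omega> $ i - e)\<^sup>2 + 2 * e * (X \<omega> $ i - e) + e\<^sup>2)"
    using sq by simp
  moreover have "(X \<omega> $ i - e)\<^sup>2 + 2 * e * (X \<omega> $ i - e) + e\<^sup>2 = (X \<omega> $ i)\<^sup>2" for \<omega>
    by (simp add: power2_eq_square algebra_simps)
  ultimately show ?thesis
    by simp
qed

text \<open>The constant \<open>b\<close> cancels on centering and independence kills the cross
  terms; square integrability lets the expectation of the expanded product be split by
  linearity.\<close>

lemma covariance_matrix_affine_indep:
  fixes X Y :: "'a \<Rightarrow> real ^ 'n" and b :: "real ^ 'n"
  assumes indep: "indep_var borel X borel Y"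
    and sqX: "\<And>i. integrable M (\<lambda>\<omega>. (X \<omega> $ i)\<^sup>2)"
    and sqY: "\<And>i. integrable M (\<lambda>\<omega>. (Y \<omega> $ i)\<^sup>2)"
  shows "covariance_matrix M (\<lambda>\<omega>. b + p *\<^sub>R X \<omega> + q *\<^sub>R Y \<omega>)
       = p\<^sup>2 *\<^sub>R covariance_matrix M X + q\<^sup>2 *\<^sub>R covariance_matrix M Y"
proof -
  have [measurable]: "X \<in> borel_measurable M" "Y \<in> borel_measurable M"
    using indep_var_rv1[OF indep] indep_var_rv2[OF indep] by simp_all
  have intX: "integrable M (\<lambda>\<omega>. X \<omega> $ i)" and intY: "integrable M (\<lambda>\<omega>. Y \<omega> $ i)" for i
    by (rule square_integrable_imp_integrable[OF _ sqX], simp)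
       (rule square_integrable_imp_integrable[OF _ sqY], simp)
  define U where "U i \<omega> = X \<omega> $ i - expectation (\<lambda>\<omega>. X \<omega> $ i)" for i \<omega>
  define V where "V i \<omega> = Y \<omega> $ i - expectation (\<lambda>\<omega>. Y \<omega> $ i)" for i \<omega>
  have [measurable]: "U i \<in> borel_measurable M" "V i \<in> borel_measurable M" for i
    by (simp_all add: U_def [abs_def] V_def [abs_def])
  have intU: "integrable M (U i)" and intV: "integrable M (V i)"
    and EU: "expectation (U i) = 0" and EV: "expectation (V i) = 0" for i
    using intX intY by (simp_all add: U_def [abs_def] V_def [abs_def] prob_space)
  have sqU: "integrable M (\<lambda>\<omega>. (U i \<omega>)\<^sup>2)" and sqV: "integrable M (\<lambda>\<omega>. (V i \<omega>)\<^sup>2)" for i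
    using sqX sqY intX intY by (simp_all add: U_def V_def power2_diff)
  have UU: "integrable M (\<lambda>\<omega>. U i \<omega> * U j \<omega>)" and VV: "integrable M (\<lambda>\<omega>. V i \<omega> * V j \<omega>)"
    and UV: "integrable M (\<lambda>\<omega>. U i \<omega> * V j \<omega>)" for i j
    using sqU sqV by (auto intro: integrable_mult_of_square_integrable)
  have EUV: "expectation (\<lambda>\<omega>. U i \<omega> * V j \<omega>) = 0" for i j
  proof -
    have "indep_var borel ((\<lambda>x. x $ i - expectation (\<lambda>\<omega>. X \<omega> $ i)) \<circ> X)
        borel ((\<lambda>y. y $ j - expectation (\<lambda>\<omega>. Y \<omega> $ j)) \<circ> Y)"
      by (rule indep_var_compose[OF indep]) simp_all
    then have "indep_var borel (U i) borel (V j)"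
      by (simp add: o_def U_def [abs_def] V_def [abs_def])
    then show ?thesis
      using indep_var_lebesgue_integral[OF _ intU intV] by (simp add: EU)
  qed
  let ?Z = "\<lambda>\<omega>. b + p *\<^sub>R X \<omega> + q *\<^sub>R Y \<omega>"
  have centered: "?Z \<omega> $ i - expectation (\<lambda>\<omega>. ?Z \<omega> $ i) = p * U i \<omega> + q * V i \<omega>" for i \<omega>
    using intX intY by (simp add: U_def V_def prob_space algebra_simps)
  have "expectation (\<lambda>\<omega>. (p * U i \<omega> + q * V i \<omega>) * (p * U j \<omega> + q * V j \<omega>))
      = p\<^sup>2 * expectation (\<lambda>\<omega>. U i \<omega> * U j \<omega>) + q\<^sup>2 * expectation (\<lambda>\<omega>. V i \<omega> * V j \<omega>)" for i j
  proof -
    have "(p * U i \<omega> + q * V i \<omega>) * (p * U j \<omega> + q * V j \<omega>)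
        = p\<^sup>2 * (U i \<omega> * U j \<omega>) + q\<^sup>2 * (V i \<omega> * V j \<omega>)
          + p * q * (U i \<omega> * V j \<omega>) + p * q * (U j \<omega> * V i \<omega>)" for \<omega>
      by (simp add: power2_eq_square algebra_simps)
    then show ?thesis
      by (simp add: UU VV UV EUV)
  qed
  then show ?thesis
    unfolding covariance_matrix_def centered by (simp add: vec_eq_iff U_def V_def)
qed

end

theorem proposition3p2:
  fixes M :: "'w measure"
    and \<alpha> \<sigma> :: "real \<Rightarrow> real"
    and t_i t_prev s_i h h' v_t v_s :: real
    and \<epsilon> :: "real ^ 'n \<Rightarrow> real \<Rightarrow> 'w \<Rightarrow> real ^ 'n"
    and x_t m1 m2 :: "real ^ 'n"
    and x_s X1 X2 \<epsilon>t \<epsilon>s :: "'w \<Rightarrow> real ^ 'n"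
    and p1 p2 :: "(real ^ 'n) measure"
  assumes "prob_space M"
    and "\<And>t. t \<in> {t_prev, s_i, t_i} \<Longrightarrow> \<alpha> t > 0 \<and> \<sigma> t > 0"
    and "t_prev < t_i" and "t_prev \<le> s_i" and "s_i < t_i"
    and "h = noise_ratio \<sigma> \<alpha> t_prev - noise_ratio \<sigma> \<alpha> t_i" and "h \<noteq> 0"
    and "h' = noise_ratio \<sigma> \<alpha> s_i - noise_ratio \<sigma> \<alpha> t_i" and "h' \<noteq> 0"
    and "\<epsilon>t = (\<lambda>\<omega>. \<epsilon> x_t t_i \<omega>)"
    and "\<epsilon>s = (\<lambda>\<omega>. \<epsilon> (x_s \<omega>) s_i \<omega>)"
    and "prob_space.indep_var M borel \<epsilon>t borel \<epsilon>s"
    and "covariance_matrix M \<epsilon>t = v_t *\<^sub>R mat 1" and "v_t > 0"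
    and "covariance_matrix M \<epsilon>s = v_s *\<^sub>R mat 1" and "v_s > 0"
    and "\<And>\<omega>. \<omega> \<in> space M \<Longrightarrow>
           scaled_state \<alpha> t_prev (X1 \<omega>) = scaled_state \<alpha> t_i x_t + h *\<^sub>R \<epsilon>t \<omega>"
    and "\<And>\<omega>. \<omega> \<in> space M \<Longrightarrow>
           scaled_state \<alpha> t_prev (X2 \<omega>) = scaled_state \<alpha> t_i x_t + h *\<^sub>R \<epsilon>t \<omega>
             + (h\<^sup>2 / 2) *\<^sub>R ((\<epsilon>s \<omega> - \<epsilon>t \<omega>) /\<^sub>R h')"
    and "p1 = gaussian_law m1 (covariance_matrix M X1)"
    and "p2 = gaussian_law m2 (covariance_matrix M X2)"
    and "h / h' \<in> {1 .. 4 * v_t / (v_s + v_t)}"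
  shows "gaussian_entropy p2 \<le> gaussian_entropy p1"
proof -
  interpret prob_space M
    by fact
  define a where "a = \<alpha> t_prev"
  define r where "r = h / h'"
  define b where "b = a *\<^sub>R scaled_state \<alpha> t_i x_t"
  have a: "a > 0"
    using assms(2)[of t_prev] by (simp add: a_def)
  have meas: "\<epsilon>t \<in> borel_measurable M" "\<epsilon>s \<in> borel_measurable M"
    using indep_var_rv1[OF assms(12)] indep_var_rv2[OF assms(12)] by simp_all
  have sq: "integrable M (\<lambda>\<omega>. (\<epsilon>t \<omega> $ i)\<^sup>2)" "integrable M (\<lambda>\<omega>. (\<epsilon>s \<omega> $ i)\<^sup>2)" for i
    using assms(13-16) by (auto intro!: square_integrable_of_covariance_matrix_diagonal meas simp: mat_def)
  have cov: "covariance_matrix M (\<lambda>\<omega>. b + p *\<^sub>R \<epsilon>t \<omega> + q *\<^sub>R \<epsilon>s \<omega>)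
      = (p\<^sup>2 * v_t + q\<^sup>2 * v_s) *\<^sub>R mat 1" for p q
    using covariance_matrix_affine_indep[OF \<open>indep_var borel \<epsilon>t borel \<epsilon>s\<close> sq] assms(13,15)
    by (simp add: scaleR_add_left)
  have unscale: "X \<omega> = a *\<^sub>R scaled_state \<alpha> t_prev (X \<omega>)" for X :: "'w \<Rightarrow> real ^ 'n" and \<omega>
    using a by (simp add: scaled_state_def a_def)
  \<comment> \<open>The zero coefficient brings the first-order iteration into the form of
    \<open>cov\<close>, which then serves both iterations.\<close>
  have X1: "X1 \<omega> = b + (a * h) *\<^sub>R \<epsilon>t \<omega> + 0 *\<^sub>R \<epsilon>s \<omega>" if "\<omega> \<in> space M" for \<omega>
    by (subst unscale) (simp add: assms(17)[OF that] b_def scaleR_add_right)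
  \<comment> \<open>Collecting the two noise terms gives
    \<open>h - h\<^sup>2 / (2 * h') = h * (1 - r / 2)\<close> and
    \<open>h\<^sup>2 / (2 * h') = h * (r / 2)\<close>.\<close>
  have X2: "X2 \<omega> = b + (a * h * (1 - r / 2)) *\<^sub>R \<epsilon>t \<omega> + (a * h * (r / 2)) *\<^sub>R \<epsilon>s \<omega>"
    if "\<omega> \<in> space M" for \<omega>
    by (subst unscale)
       (simp add: assms(18)[OF that] b_def r_def vec_eq_iff power2_eq_square field_simps \<open>h' \<noteq> 0\<close>)
  define c1 where "c1 = (a * h)\<^sup>2 * v_t"
  define c2 where "c2 = (a * h)\<^sup>2 * ((1 - r / 2)\<^sup>2 * v_t + (r / 2)\<^sup>2 * v_s)"
  have "covariance_matrix M X1 = c1 *\<^sub>R mat 1"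
    by (subst covariance_matrix_cong, erule X1) (simp only: cov, simp add: c1_def)
  then have p1: "p1 = gaussian_law m1 (c1 *\<^sub>R mat 1)"
    by (simp add: assms(19))
  have "covariance_matrix M X2 = c2 *\<^sub>R mat 1"
    by (subst covariance_matrix_cong, erule X2)
       (simp only: cov c2_def power_mult_distrib distrib_left mult.assoc)
  then have p2: "p2 = gaussian_law m2 (c2 *\<^sub>R mat 1)"
    by (simp add: assms(20))
  have r: "1 \<le> r" "r * (v_s + v_t) \<le> 4 * v_t"
    using assms(14,16,21) by (simp_all add: r_def pos_le_divide_eq)
  have "0 < c1"
    using a \<open>h \<noteq> 0\<close> \<open>v_t > 0\<close> by (simp add: c1_def)
  \<comment> \<open>The coefficient \<open>1 - r / 2\<close> vanishes at \<open>r = 2\<close>, so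
    strict positivity is drawn from the \<open>v_s\<close> term, using
    \<open>r \<ge> 1\<close>.\<close>
  have "0 < c2"
    unfolding c2_def using a \<open>h \<noteq> 0\<close> \<open>v_t > 0\<close> \<open>v_s > 0\<close> r(1)
    by (intro mult_pos_pos add_nonneg_pos) auto
  \<comment> \<open>Multiplying the upper bound by \<open>r\<close> yields exactly the quadratic
    inequality left after expanding the squares and cancelling \<open>v_t\<close>.\<close>
  have "r * (r * (v_s + v_t)) \<le> r * (4 * v_t)"
    using r by (intro mult_left_mono) auto
  then have "(1 - r / 2)\<^sup>2 * v_t + (r / 2)\<^sup>2 * v_s \<le> v_t"
    by (simp add: power2_eq_square field_simps)
  then have "c2 \<le> c1"
    unfolding c1_def c2_def by (intro mult_left_mono) auto
  then show ?thesis
    using \<open>0 < c1\<close> \<open>0 < c2\<close> by (simp add: p1 p2 gaussian_entropy_isotropic mult_left_mono)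
qed

end
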